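(* Let $\mathcal A$ be a cluster algebra which has a monoidal categorification $\mathcal M$. Then: (i) every cluster variable of $\mathcal A$ has a Laurent expansion with positive (i.e. nonnegative integer) coefficients with respect to any cluster of $\mathcal A$; (ii) the cluster monomials of $\mathcal A$ are linearly independent.
   Context: Cluster algebras. Let $0\le n<r$ be integers and let $\widetilde B=(b_{ij})$ be an $r\times(r-n)$ integer matrix whose principal part (the top $(r-n)\times(r-n)$ submatrix) is skew-symmetric. Let $\mathcal F=\mathbb Q(x_1,\dots,x_r)$ and $\mathbf x=(x_1,\dots,x_r)$. For $1\le k\le r-n$ the mutation $\mu_k(\widetilde B)=(b'_{ij})$ is given by $b'_{ij}=-b_{ij}$ if $i=k$ or $j=k$, and $b'_{ij}=b_{ij}+\frac{|b_{ik}|b_{kj}+b_{ik}|b_{kj}|}{2}$ otherwise; $\mu_k(\mathbf x)$ is obtained from $\mathbf x$ by replacing $x_k$ by $$x_k^*=\frac{\prod_{b_{ik}>0}x_i^{b_{ik}}+\prod_{b_{ik}<0}x_i^{-b_{ik}}}{x_k}.$$ Starting from the initial seed $(\mathbf x,\widetilde B)$ one obtains seeds by iterating mutations in all directions $1\le k\le r-n$. The $r$-tuple of elements of $\mathcal F$ in a seed is a cluster, its entries are cluster variables; the last $n$ entries are never mutated, belong to every cluster, and are called frozen variables. The cluster algebra $\mathcal A(\widetilde B)$ is the subring of $\mathcal F$ generated by all cluster variables of all seeds. A cluster monomial is a monomial (nonnegative exponents) in the cluster variables of a single cluster. Every cluster variable is a Laurent polynomial with integer coefficients in the elements of any given cluster.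 Monoidal categorification. A simple object $S$ of a monoidal category is prime if there is no nontrivial factorization $S\cong S_1\otimes S_2$; it is real if $S\otimes S$ is simple. An abelian monoidal category $\mathcal M$ is a monoidal categorification of $\mathcal A$ if the Grothendieck ring of $\mathcal M$ is isomorphic to $\mathcal A$ and, under this isomorphism, (1) the cluster monomials of $\mathcal A$ are the classes of all the real simple objects of $\mathcal M$, and (2) the cluster variables of $\mathcal A$ (including the frozen ones) are the classes of all the real prime simple objects of $\mathcal M$. It is understood that the tensor product of $\mathcal M$ induces the multiplication of the Grothendieck ring, that objects have finite length, and that the classes of the simple objects form a $\mathbb Z$-basis of the Grothendieck group, the class of an object being the sum of its composition factors with multiplicity. *)

theory Defs
  imports
    "HOL-Library.Poly_Mapping"
    "HOL-Computational_Algebra.Fraction_Field"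
    "HOL-Algebra.QuotRing"
    "HOL-Algebra.Generated_Rings"
    "HOL-Algebra.Free_Abelian_Groups"
    "HOL-Algebra.Algebraic_Closure_Type"
    "Jordan_Normal_Form.Matrix"
begin

text \<open>Frees the identifier \<open>X\<close>.\<close>
no_notation Polynomials.var (\<open>X\<index>\<close>)

section \<open>Cluster algebras of geometric type\<close>

text \<open>
  \<open>\<rat>(x\<^sub>0, x\<^sub>1, \<dots>)\<close>.  All seeds of an \<open>r\<close>-rowed matrix live in the subfield
  \<open>\<rat>(x\<^sub>0, \<dots>, x\<^sub>r\<^sub>-\<^sub>1)\<close>, so one ambient field serves every \<open>r\<close>.
  Indices start at \<open>0\<close> throughout.
\<close>
type_synonym ratfun = "((nat \<Rightarrow>\<^sub>0 nat) \<Rightarrow>\<^sub>0 rat) fract"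

definition ratvar :: "nat \<Rightarrow> ratfun" where
  "ratvar i = Fract (Poly_Mapping.single (Poly_Mapping.single i 1) 1) 1"

definition principal_skew_symmetric :: "int mat \<Rightarrow> bool" where
  "principal_skew_symmetric B \<longleftrightarrow>
     (\<forall>i < dim_col B. \<forall>j < dim_col B. B $$ (i, j) = - B $$ (j, i))"

text \<open>The division by \<open>2\<close> is exact: \<open>\<bar>a\<bar> * b + a * \<bar>b\<bar>\<close> is \<open>0\<close> or \<open>\<plusminus> 2 * a * b\<close>.\<close>
definition mutate_mat :: "nat \<Rightarrow> int mat \<Rightarrow> int mat" where
  "mutate_mat k B = mat (dim_row B) (dim_col B) (\<lambda>(i, j).
     if i = k \<or> j = k then - B $$ (i, j)
     else B $$ (i, j) +
       (\<bar>B $$ (i, k)\<bar> * B $$ (k, j) + B $$ (i, k) * \<bar>B $$ (k, j)\<bar>) div 2)"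

definition mutate_cluster :: "nat \<Rightarrow> int mat \<Rightarrow> 'a::field vec \<Rightarrow> 'a vec" where
  "mutate_cluster k B x = vec (dim_vec x) (\<lambda>i.
     if i = k then
       ((\<Prod>j | j < dim_row B \<and> B $$ (j, k) > 0. x $ j ^ nat (B $$ (j, k))) +
        (\<Prod>j | j < dim_row B \<and> B $$ (j, k) < 0. x $ j ^ nat (- B $$ (j, k)))) / x $ k
     else x $ i)"

inductive_set seeds :: "int mat \<Rightarrow> (ratfun vec \<times> int mat) set" for B :: "int mat" where
  initial: "(vec (dim_row B) ratvar, B) \<in> seeds B"
| mutation: "(mutate_cluster k B' x, mutate_mat k B') \<in> seeds B"
    if "(x, B') \<in> seeds B" and "k < dim_col B"

definition clusters :: "int mat \<Rightarrow> ratfun vec set" where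
  "clusters B = fst ` seeds B"

definition cluster_variables :: "int mat \<Rightarrow> ratfun set" where
  "cluster_variables B = (\<Union>x \<in> clusters B. {x $ i | i. i < dim_row B})"

definition cluster_monomials :: "int mat \<Rightarrow> ratfun set" where
  "cluster_monomials B =
     (\<Union>x \<in> clusters B. {\<Prod>i<dim_row B. x $ i ^ a i | a :: nat \<Rightarrow> nat. True})"

definition cluster_algebra :: "int mat \<Rightarrow> ratfun ring" where
  "cluster_algebra B =
     ring_of_type_algebra\<lparr>carrier := generate_ring ring_of_type_algebra (cluster_variables B)\<rparr>"

text \<open>
  Laurent polynomials with integer coefficients in variables indexed by \<open>nat\<close>, as finitely
  supported functions on exponent vectors, and their values at a vector.
\<close>
type_synonym laurent = "(nat \<Rightarrow>\<^sub>0 int) \<Rightarrow>\<^sub>0 int"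

definition laurent_in :: "nat \<Rightarrow> laurent \<Rightarrow> bool" where
  "laurent_in r p \<longleftrightarrow> (\<forall>e \<in> Poly_Mapping.keys p. Poly_Mapping.keys e \<subseteq> {..<r})"

definition laurent_eval :: "'a::field vec \<Rightarrow> laurent \<Rightarrow> 'a" where
  "laurent_eval x p = (\<Sum>e \<in> Poly_Mapping.keys p.
     of_int (Poly_Mapping.lookup p e) * (\<Prod>i<dim_vec x. x $ i powi Poly_Mapping.lookup e i))"

definition nonneg_coeffs :: "laurent \<Rightarrow> bool" where
  "nonneg_coeffs p \<longleftrightarrow> (\<forall>e. Poly_Mapping.lookup p e \<ge> 0)"


section \<open>Abelian monoidal categories\<close>

record ('o, 'm) category_data =
  Obj :: "'o set"
  Mor :: "'m set"
  Dom :: "'m \<Rightarrow> 'o"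
  Cod :: "'m \<Rightarrow> 'o"
  Ident :: "'o \<Rightarrow> 'm"
  Comp :: "'m \<Rightarrow> 'm \<Rightarrow> 'm" (infixr \<open>\<star>\<index>\<close> 70)

definition Hom :: "('o, 'm, 'z) category_data_scheme \<Rightarrow> 'o \<Rightarrow> 'o \<Rightarrow> 'm set" where
  "Hom C X Y = {f \<in> Mor C. Dom C f = X \<and> Cod C f = Y}"

text \<open>\<open>g \<star> f\<close> is \<open>g\<close> after \<open>f\<close>.\<close>
locale category =
  fixes C :: "('o, 'm, 'z) category_data_scheme" (structure)
  assumes Dom_closed: "f \<in> Mor C \<Longrightarrow> Dom C f \<in> Obj C"
    and Cod_closed: "f \<in> Mor C \<Longrightarrow> Cod C f \<in> Obj C"
    and Ident_closed: "X \<in> Obj C \<Longrightarrow> Ident C X \<in> Hom C X X"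
    and Comp_closed: "\<lbrakk>f \<in> Hom C X Y; g \<in> Hom C Y Z\<rbrakk> \<Longrightarrow> g \<star> f \<in> Hom C X Z"
    and Ident_left: "f \<in> Hom C X Y \<Longrightarrow> Ident C Y \<star> f = f"
    and Ident_right: "f \<in> Hom C X Y \<Longrightarrow> f \<star> Ident C X = f"
    and Comp_assoc: "\<lbrakk>f \<in> Hom C W X; g \<in> Hom C X Y; h \<in> Hom C Y Z\<rbrakk>
      \<Longrightarrow> (h \<star> g) \<star> f = h \<star> (g \<star> f)"

context
  fixes C :: "('o, 'm, 'z) category_data_scheme" (structure)
begin

definition is_iso :: "'m \<Rightarrow> bool" where
  "is_iso f \<longleftrightarrow> f \<in> Mor C \<and> (\<exists>g \<in> Hom C (Cod C f) (Dom C f).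
     g \<star> f = Ident C (Dom C f) \<and> f \<star> g = Ident C (Cod C f))"

definition isomorphic :: "'o \<Rightarrow> 'o \<Rightarrow> bool" where
  "isomorphic X Y \<longleftrightarrow> (\<exists>f \<in> Hom C X Y. is_iso f)"

definition is_mono :: "'m \<Rightarrow> bool" where
  "is_mono f \<longleftrightarrow> f \<in> Mor C \<and>
     (\<forall>W. \<forall>g \<in> Hom C W (Dom C f). \<forall>h \<in> Hom C W (Dom C f). f \<star> g = f \<star> h \<longrightarrow> g = h)"

definition is_epi :: "'m \<Rightarrow> bool" where
  "is_epi f \<longleftrightarrow> f \<in> Mor C \<and>
     (\<forall>W. \<forall>g \<in> Hom C (Cod C f) W. \<forall>h \<in> Hom C (Cod C f) W. g \<star> f = h \<star> f \<longrightarrow> g = h)"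

definition is_zero_obj :: "'o \<Rightarrow> bool" where
  "is_zero_obj Z \<longleftrightarrow> Z \<in> Obj C \<and>
     (\<forall>X \<in> Obj C. (\<exists>!f. f \<in> Hom C X Z) \<and> (\<exists>!f. f \<in> Hom C Z X))"

definition is_zero_mor :: "'m \<Rightarrow> bool" where
  "is_zero_mor f \<longleftrightarrow>
     (\<exists>Z. is_zero_obj Z \<and> (\<exists>g \<in> Hom C (Dom C f) Z. \<exists>h \<in> Hom C Z (Cod C f). f = h \<star> g))"

definition is_kernel :: "'m \<Rightarrow> 'm \<Rightarrow> bool" where
  "is_kernel k f \<longleftrightarrow> f \<in> Mor C \<and> k \<in> Mor C \<and> Cod C k = Dom C f \<and> is_zero_mor (f \<star> k) \<and>
     (\<forall>W. \<forall>g \<in> Hom C W (Dom C f). is_zero_mor (f \<star> g) \<longrightarrow>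
        (\<exists>!h. h \<in> Hom C W (Dom C k) \<and> k \<star> h = g))"

definition is_cokernel :: "'m \<Rightarrow> 'm \<Rightarrow> bool" where
  "is_cokernel q f \<longleftrightarrow> f \<in> Mor C \<and> q \<in> Mor C \<and> Dom C q = Cod C f \<and> is_zero_mor (q \<star> f) \<and>
     (\<forall>W. \<forall>g \<in> Hom C (Cod C f) W. is_zero_mor (g \<star> f) \<longrightarrow>
        (\<exists>!h. h \<in> Hom C (Cod C q) W \<and> h \<star> q = g))"

definition is_product :: "'o \<Rightarrow> 'o \<Rightarrow> 'o \<Rightarrow> 'm \<Rightarrow> 'm \<Rightarrow> bool" where
  "is_product X Y P p q \<longleftrightarrow> p \<in> Hom C P X \<and> q \<in> Hom C P Y \<and>
     (\<forall>W. \<forall>f \<in> Hom C W X. \<forall>g \<in> Hom C W Y.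
        \<exists>!h. h \<in> Hom C W P \<and> p \<star> h = f \<and> q \<star> h = g)"

definition is_coproduct :: "'o \<Rightarrow> 'o \<Rightarrow> 'o \<Rightarrow> 'm \<Rightarrow> 'm \<Rightarrow> bool" where
  "is_coproduct X Y S i j \<longleftrightarrow> i \<in> Hom C X S \<and> j \<in> Hom C Y S \<and>
     (\<forall>W. \<forall>f \<in> Hom C X W. \<forall>g \<in> Hom C Y W.
        \<exists>!h. h \<in> Hom C S W \<and> h \<star> i = f \<and> h \<star> j = g)"

definition short_exact :: "'o \<Rightarrow> 'o \<Rightarrow> 'o \<Rightarrow> bool" where
  "short_exact X Y Z \<longleftrightarrow>
     (\<exists>i \<in> Hom C X Y. \<exists>p \<in> Hom C Y Z. is_kernel i p \<and> is_cokernel p i)"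

definition is_simple :: "'o \<Rightarrow> bool" where
  "is_simple S \<longleftrightarrow> S \<in> Obj C \<and> \<not> is_zero_obj S \<and>
     (\<forall>X. \<forall>f \<in> Hom C X S. is_mono f \<longrightarrow> is_zero_obj X \<or> is_iso f)"

text \<open>
  Existence of a composition series \<open>0 = X\<^sub>0 \<subseteq> X\<^sub>1 \<subseteq> \<dots> \<subseteq> X\<^sub>l\<close>, built by adding one simple
  quotient \<open>S\<close> at a time.
\<close>
inductive finite_length :: "'o \<Rightarrow> bool" where
  zero: "finite_length X" if "is_zero_obj X"
| extend: "finite_length Y" if "finite_length X" and "short_exact X Y S" and "is_simple S"

end

text \<open>
  Freyd's axioms.  The abelian group structure on the Hom sets is determined by them, so it is
  not part of the data.
\<close>
locale abelian_category = category +
  assumes ex_zero_obj: "\<exists>Z. is_zero_obj C Z"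
    and ex_product: "\<lbrakk>X \<in> Obj C; Y \<in> Obj C\<rbrakk> \<Longrightarrow> \<exists>P p q. is_product C X Y P p q"
    and ex_coproduct: "\<lbrakk>X \<in> Obj C; Y \<in> Obj C\<rbrakk> \<Longrightarrow> \<exists>S i j. is_coproduct C X Y S i j"
    and ex_kernel: "f \<in> Mor C \<Longrightarrow> \<exists>k. is_kernel C k f"
    and ex_cokernel: "f \<in> Mor C \<Longrightarrow> \<exists>q. is_cokernel C q f"
    and mono_is_kernel: "is_mono C f \<Longrightarrow> \<exists>g. is_kernel C f g"
    and epi_is_cokernel: "is_epi C f \<Longrightarrow> \<exists>g. is_cokernel C f g"

record ('o, 'm) monoidal_data = "('o, 'm) category_data" +
  TObj :: "'o \<Rightarrow> 'o \<Rightarrow> 'o" (infixr \<open>\<boxtimes>\<index>\<close> 75)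
  TMor :: "'m \<Rightarrow> 'm \<Rightarrow> 'm" (infixr \<open>\<boxtimes>\<^sub>m\<index>\<close> 75)
  Unit :: "'o"
  Assoc :: "'o \<Rightarrow> 'o \<Rightarrow> 'o \<Rightarrow> 'm"
  LUnit :: "'o \<Rightarrow> 'm"
  RUnit :: "'o \<Rightarrow> 'm"

locale monoidal_category = category C
  for C :: "('o, 'm, 'z) monoidal_data_scheme" (structure) +
  assumes Unit_closed: "Unit C \<in> Obj C"
    and TObj_closed: "\<lbrakk>X \<in> Obj C; Y \<in> Obj C\<rbrakk> \<Longrightarrow> X \<boxtimes> Y \<in> Obj C"
    and TMor_closed: "\<lbrakk>f \<in> Hom C X X'; g \<in> Hom C Y Y'\<rbrakk>
      \<Longrightarrow> f \<boxtimes>\<^sub>m g \<in> Hom C (X \<boxtimes> Y) (X' \<boxtimes> Y')"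
    and TMor_Ident: "\<lbrakk>X \<in> Obj C; Y \<in> Obj C\<rbrakk>
      \<Longrightarrow> Ident C X \<boxtimes>\<^sub>m Ident C Y = Ident C (X \<boxtimes> Y)"
    and TMor_Comp: "\<lbrakk>f \<in> Hom C X X'; f' \<in> Hom C X' X''; g \<in> Hom C Y Y'; g' \<in> Hom C Y' Y''\<rbrakk>
      \<Longrightarrow> (f' \<star> f) \<boxtimes>\<^sub>m (g' \<star> g) = (f' \<boxtimes>\<^sub>m g') \<star> (f \<boxtimes>\<^sub>m g)"
    and Assoc_closed: "\<lbrakk>X \<in> Obj C; Y \<in> Obj C; Z \<in> Obj C\<rbrakk>
      \<Longrightarrow> Assoc C X Y Z \<in> Hom C ((X \<boxtimes> Y) \<boxtimes> Z) (X \<boxtimes> (Y \<boxtimes> Z))"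
    and Assoc_iso: "\<lbrakk>X \<in> Obj C; Y \<in> Obj C; Z \<in> Obj C\<rbrakk> \<Longrightarrow> is_iso C (Assoc C X Y Z)"
    and Assoc_natural: "\<lbrakk>f \<in> Hom C X X'; g \<in> Hom C Y Y'; h \<in> Hom C Z Z'\<rbrakk>
      \<Longrightarrow> Assoc C X' Y' Z' \<star> ((f \<boxtimes>\<^sub>m g) \<boxtimes>\<^sub>m h) = (f \<boxtimes>\<^sub>m (g \<boxtimes>\<^sub>m h)) \<star> Assoc C X Y Z"
    and LUnit_closed: "X \<in> Obj C \<Longrightarrow> LUnit C X \<in> Hom C (Unit C \<boxtimes> X) X"
    and LUnit_iso: "X \<in> Obj C \<Longrightarrow> is_iso C (LUnit C X)"
    and LUnit_natural: "f \<in> Hom C X X'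
      \<Longrightarrow> LUnit C X' \<star> (Ident C (Unit C) \<boxtimes>\<^sub>m f) = f \<star> LUnit C X"
    and RUnit_closed: "X \<in> Obj C \<Longrightarrow> RUnit C X \<in> Hom C (X \<boxtimes> Unit C) X"
    and RUnit_iso: "X \<in> Obj C \<Longrightarrow> is_iso C (RUnit C X)"
    and RUnit_natural: "f \<in> Hom C X X'
      \<Longrightarrow> RUnit C X' \<star> (f \<boxtimes>\<^sub>m Ident C (Unit C)) = f \<star> RUnit C X"
    and pentagon: "\<lbrakk>W \<in> Obj C; X \<in> Obj C; Y \<in> Obj C; Z \<in> Obj C\<rbrakk>
      \<Longrightarrow> (Ident C W \<boxtimes>\<^sub>m Assoc C X Y Z) \<star> Assoc C W (X \<boxtimes> Y) Z \<star> (Assoc C W X Y \<boxtimes>\<^sub>m Ident C Z)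
        = Assoc C W X (Y \<boxtimes> Z) \<star> Assoc C (W \<boxtimes> X) Y Z"
    and triangle: "\<lbrakk>X \<in> Obj C; Y \<in> Obj C\<rbrakk>
      \<Longrightarrow> (Ident C X \<boxtimes>\<^sub>m LUnit C Y) \<star> Assoc C X (Unit C) Y = RUnit C X \<boxtimes>\<^sub>m Ident C Y"

definition is_real_simple :: "('o, 'm, 'z) monoidal_data_scheme \<Rightarrow> 'o \<Rightarrow> bool" where
  "is_real_simple C S \<longleftrightarrow> is_simple C S \<and> is_simple C (S \<boxtimes>\<^bsub>C\<^esub> S)"

text \<open>
  A factorization is trivial if one of its factors is the unit object.  As with the number
  \<open>1\<close>, the unit object itself is not counted as prime.
\<close>
definition is_prime_simple :: "('o, 'm, 'z) monoidal_data_scheme \<Rightarrow> 'o \<Rightarrow> bool" where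
  "is_prime_simple C S \<longleftrightarrow> is_simple C S \<and> \<not> isomorphic C S (Unit C) \<and>
     (\<forall>S1 \<in> Obj C. \<forall>S2 \<in> Obj C. isomorphic C S (S1 \<boxtimes>\<^bsub>C\<^esub> S2) \<longrightarrow>
        isomorphic C S1 (Unit C) \<or> isomorphic C S2 (Unit C))"


section \<open>The Grothendieck ring\<close>

text \<open>
  The free abelian group on the objects, with the bilinear extension of the tensor product as
  multiplication.  It is associative and unital only up to isomorphism of objects, hence in
  general not a ring before passing to the quotient below.
\<close>
definition free_tensor :: "('o, 'm, 'z) monoidal_data_scheme \<Rightarrow> ('o \<Rightarrow>\<^sub>0 int) ring" where
  "free_tensor C =
     \<lparr>carrier = carrier (free_Abelian_group (Obj C)),
      monoid.mult = (\<lambda>a b. frag_extend (\<lambda>X. frag_extend (\<lambda>Y. frag_of (X \<boxtimes>\<^bsub>C\<^esub> Y)) b) a),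
      one = frag_of (Unit C),
      ring.zero = 0,
      ring.add = (+)\<rparr>"

definition exact_relations :: "('o, 'm, 'z) category_data_scheme \<Rightarrow> ('o \<Rightarrow>\<^sub>0 int) set" where
  "exact_relations C = generate (free_Abelian_group (Obj C))
     {frag_of Y - frag_of X - frag_of Z | X Y Z. short_exact C X Y Z}"

definition grothendieck_ring ::
    "('o, 'm, 'z) monoidal_data_scheme \<Rightarrow> ('o \<Rightarrow>\<^sub>0 int) set ring" where
  "grothendieck_ring C = free_tensor C Quot exact_relations C"

definition object_class ::
    "('o, 'm, 'z) monoidal_data_scheme \<Rightarrow> 'o \<Rightarrow> ('o \<Rightarrow>\<^sub>0 int) set" where
  "object_class C X = exact_relations C +>\<^bsub>free_tensor C\<^esub> frag_of X"

text \<open>The multiplication of \<^const>\<open>free_tensor\<close> descends to the quotient.\<close>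
definition tensor_induces_mult :: "('o, 'm, 'z) monoidal_data_scheme \<Rightarrow> bool" where
  "tensor_induces_mult C \<longleftrightarrow>
     (\<forall>a \<in> exact_relations C. \<forall>b \<in> carrier (free_tensor C).
        a \<otimes>\<^bsub>free_tensor C\<^esub> b \<in> exact_relations C \<and>
        b \<otimes>\<^bsub>free_tensor C\<^esub> a \<in> exact_relations C)"

definition is_Z_basis :: "('a, 'b) ring_scheme \<Rightarrow> 'a set \<Rightarrow> bool" where
  "is_Z_basis R S \<longleftrightarrow> S \<subseteq> carrier R \<and>
     (\<forall>x \<in> carrier R. \<exists>!c. c \<in> carrier (free_Abelian_group S) \<and>
        x = (\<Oplus>\<^bsub>R\<^esub> s \<in> Poly_Mapping.keys c. [Poly_Mapping.lookup c s] \<cdot>\<^bsub>R\<^esub> s))"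


section \<open>Monoidal categorification\<close>

definition monoidal_categorification ::
    "('o, 'm, 'z) monoidal_data_scheme \<Rightarrow> int mat \<Rightarrow> bool" where
  "monoidal_categorification C B \<longleftrightarrow>
     abelian_category C \<and> monoidal_category C \<and>
     (\<forall>X \<in> Obj C. finite_length C X) \<and>
     tensor_induces_mult C \<and>
     is_Z_basis (grothendieck_ring C) {object_class C S | S. is_simple C S} \<and>
     (\<exists>\<phi> \<in> ring_iso (grothendieck_ring C) (cluster_algebra B).
        cluster_monomials B = {\<phi> (object_class C S) | S. is_real_simple C S} \<and>
        cluster_variables B =
          {\<phi> (object_class C S) | S. is_real_simple C S \<and> is_prime_simple C S})"

end

theory Submission
  imports Defs
begin

text \<open>
  Through the categorification, the classes of the simple objects become a subset \<open>S\<close> of the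
  field of rational functions which is linearly independent over \<open>\<int>\<close>.  A product of two elements
  of \<open>S\<close> is the class of a tensor product, an object of finite length, and therefore a
  combination of elements of \<open>S\<close> with coefficients in \<open>\<nat>\<close>
  (\<open>monoidal_categorification_classes\<close>).  All cluster monomials belong to \<open>S\<close>, so they are
  linearly independent.

  For positivity, let \<open>z\<close> be a cluster variable and \<open>x\<close> a cluster, and let \<open>X \<subseteq> S\<close> be the set of
  monomials in \<open>x\<close>.  Exchange relations contain no subtraction and can be traversed in both
  directions, so \<open>z\<close> is a subtraction-free rational expression in \<open>x\<close>
  (\<open>subtraction_free_cluster\<close>); hence \<open>z * Q = P\<close> for combinations \<open>P\<close> and \<open>Q \<noteq> 0\<close> of
  elements of \<open>X\<close> with coefficients in \<open>\<nat>\<close>.  Let \<open>m\<close> be one of the monomials of \<open>Q\<close>.  Expanded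
  in \<open>S\<close>, the product \<open>z * m\<close> has nonnegative coefficients, and so has the rest \<open>z * (Q - m)\<close> of
  the sum \<open>P\<close>.  There is no cancellation, and \<open>P\<close> involves elements of \<open>X\<close> only; therefore
  \<open>z * m\<close> is a combination of monomials in \<open>x\<close> with coefficients in \<open>\<nat>\<close>
  (\<open>subtraction_free_monomial_denominator\<close>).  Division by the monomial \<open>m\<close> gives the Laurent
  expansion.  In this way the categorification yields the Laurent phenomenon together with
  positivity.
\<close>

section \<open>Nonnegative combinations of independent elements\<close>

abbreviation int_independent :: "'a::comm_ring_1 set \<Rightarrow> bool" where
  "int_independent S \<equiv> module.independent (\<lambda>(c::int) z. of_int c * z) S"

lemma int_module: "Modules.module (\<lambda>(c::int) (z::'a::comm_ring_1). of_int c * z)"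
  by unfold_locales (simp_all add: algebra_simps)

lemma int_independentD:
  assumes "int_independent S" "finite t" "t \<subseteq> S"
    and "(\<Sum>v\<in>t. of_int (u v) * v) = 0" and "v \<in> t"
  shows "u v = 0"
  using assms unfolding module.dependent_explicit[OF int_module] by blast

lemma int_independentI:
  assumes "\<And>t u v. \<lbrakk>finite t; t \<subseteq> S; (\<Sum>v\<in>t. of_int (u v) * v) = 0; v \<in> t\<rbrakk> \<Longrightarrow> u v = 0"
  shows "int_independent S"
  using assms unfolding module.dependent_explicit[OF int_module] by blast

lemma int_independent_mono: "int_independent T \<Longrightarrow> S \<subseteq> T \<Longrightarrow> int_independent S"
  using module.dependent_mono[OF int_module] by blast

lemma int_independent_nonzero:
  assumes "int_independent S" "s \<in> S"
  shows "s \<noteq> 0"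
  using int_independentD[OF assms(1), of "{s}" "\<lambda>_. 1" s] assms(2) by auto

lemma sum_mset_eq_sum_count:
  fixes U :: "'a::comm_semiring_1 multiset"
  assumes "finite A" "set_mset U \<subseteq> A"
  shows "sum_mset U = (\<Sum>v\<in>A. of_nat (count U v) * v)"
  using assms(2)
proof (induction U)
  case empty
  then show ?case by simp
next
  case (add u U)
  have "(\<Sum>v\<in>A. of_nat (count (add_mset u U) v) * v)
      = (\<Sum>v\<in>A. (if v = u then v else 0) + of_nat (count U v) * v)"
    by (intro sum.cong) (auto simp: algebra_simps)
  also have "\<dots> = u + sum_mset U"
    using add assms(1) by (simp add: sum.distrib)
  finally show ?case by simp
qed

lemma int_independent_mset_unique:
  assumes ind: "int_independent S" and sub: "set_mset U \<subseteq> S" "set_mset V \<subseteq> S"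
    and eq: "sum_mset U = sum_mset V"
  shows "U = V"
proof (rule multiset_eqI)
  fix v
  let ?t = "set_mset U \<union> set_mset V"
  have "(\<Sum>v\<in>?t. of_int (int (count U v) - int (count V v)) * v) = 0"
    using eq sum_mset_eq_sum_count[of ?t U] sum_mset_eq_sum_count[of ?t V]
    by (simp add: left_diff_distrib sum_subtractf)
  then have "int (count U v) - int (count V v) = 0" if "v \<in> ?t"
    using int_independentD[OF ind, of ?t "\<lambda>v. int (count U v) - int (count V v)" v] sub that by auto
  then show "count U v = count V v"
    by (cases "v \<in> ?t") (auto simp: not_in_iff)
qed

text \<open>
  Multisets record combinations with coefficients in \<open>\<nat>\<close>, so that addition of combinations is
  union of multisets and no cancellation can be hidden in the notation.
\<close>
definition nat_combinations :: "'a::comm_monoid_add set \<Rightarrow> 'a set" where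
  "nat_combinations S = {sum_mset U | U. set_mset U \<subseteq> S}"

lemma nat_combinations_zero: "0 \<in> nat_combinations S"
  unfolding nat_combinations_def by (intro CollectI exI[of _ "{#}"]) simp

lemma nat_combinations_base: "s \<in> S \<Longrightarrow> s \<in> nat_combinations S"
  unfolding nat_combinations_def by (intro CollectI exI[of _ "{#s#}"]) simp

lemma nat_combinations_add:
  "\<lbrakk>u \<in> nat_combinations S; v \<in> nat_combinations S\<rbrakk> \<Longrightarrow> u + v \<in> nat_combinations S"
  unfolding nat_combinations_def
  by clarify (metis (no_types, lifting) Un_least set_mset_union sum_mset.union)

lemma nat_combinations_induct [consumes 1, case_names zero add]:
  assumes "u \<in> nat_combinations S" "P 0"
    and "\<And>s u. \<lbrakk>s \<in> S; u \<in> nat_combinations S; P u\<rbrakk> \<Longrightarrow> P (s + u)"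
  shows "P u"
proof -
  have "set_mset U \<subseteq> S \<Longrightarrow> P (sum_mset U)" for U
    by (induction U) (use assms(2,3) in \<open>auto simp: nat_combinations_def\<close>)
  then show ?thesis using assms(1) by (auto simp: nat_combinations_def)
qed

lemma nat_combinations_mult:
  fixes S :: "'a::comm_semiring_1 set"
  assumes "\<And>s t. \<lbrakk>s \<in> S; t \<in> T\<rbrakk> \<Longrightarrow> s * t \<in> nat_combinations R"
    and "u \<in> nat_combinations S" "v \<in> nat_combinations T"
  shows "u * v \<in> nat_combinations R"
  using assms(2)
proof (induction rule: nat_combinations_induct)
  case zero
  show ?case by (simp add: nat_combinations_zero)
next
  case (add s u)
  have "s * v \<in> nat_combinations R"
    using assms(3)
  proof (induction rule: nat_combinations_induct)
    case (add t v)
    then show ?case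
      using assms(1) \<open>s \<in> S\<close> by (auto simp: distrib_left intro: nat_combinations_add)
  qed (simp add: nat_combinations_zero)
  then show ?case using add by (simp add: distrib_right nat_combinations_add)
qed

text \<open>
  Coefficients in \<open>\<nat>\<close> cannot cancel: what is added to a combination stays visible in the sum.
\<close>
lemma nat_combinations_summand:
  assumes ind: "int_independent S" and "T \<subseteq> S"
    and u: "u \<in> nat_combinations S" and v: "v \<in> nat_combinations S"
    and uv: "u + v \<in> nat_combinations T"
  shows "u \<in> nat_combinations T"
proof -
  obtain U V W where *: "u = sum_mset U" "set_mset U \<subseteq> S" "v = sum_mset V" "set_mset V \<subseteq> S"
      "u + v = sum_mset W" "set_mset W \<subseteq> T"
    using u v uv by (auto simp: nat_combinations_def)
  then have "U + V = W"
    using int_independent_mset_unique[OF ind, of "U + V" W] \<open>T \<subseteq> S\<close> by auto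
  then show ?thesis using * by (auto simp: nat_combinations_def)
qed

text \<open>
  This keeps the numerators of the exchange relations away from zero, so that the relations can be
  solved for the old variable.
\<close>
lemma int_independent_add_nonzero:
  assumes "int_independent S" "s \<in> S" "u \<in> nat_combinations S"
  shows "s + u \<noteq> 0"
proof
  assume "s + u = 0"
  then have "s \<in> nat_combinations {}"
    using nat_combinations_summand[OF assms(1) _ nat_combinations_base assms(3), of "{}" s]
      assms(2) nat_combinations_zero[of "{}"] by simp
  then have "s = 0" by (auto simp: nat_combinations_def)
  then show False using int_independent_nonzero[OF assms(1,2)] by simp
qed


section \<open>Subtraction-free rational expressions\<close>

inductive_set subtraction_free :: "'a::field set \<Rightarrow> 'a set" for G where
  gen: "g \<in> G \<Longrightarrow> g \<in> subtraction_free G"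
| one: "1 \<in> subtraction_free G"
| add: "\<lbrakk>u \<in> subtraction_free G; v \<in> subtraction_free G\<rbrakk> \<Longrightarrow> u + v \<in> subtraction_free G"
| mult: "\<lbrakk>u \<in> subtraction_free G; v \<in> subtraction_free G\<rbrakk> \<Longrightarrow> u * v \<in> subtraction_free G"
| inverse: "u \<in> subtraction_free G \<Longrightarrow> inverse u \<in> subtraction_free G"

lemma subtraction_free_divide:
  "\<lbrakk>u \<in> subtraction_free G; v \<in> subtraction_free G\<rbrakk> \<Longrightarrow> u / v \<in> subtraction_free G"
  by (simp add: field_class.field_divide_inverse subtraction_free.mult subtraction_free.inverse)

lemma subtraction_free_power: "u \<in> subtraction_free G \<Longrightarrow> u ^ n \<in> subtraction_free G"
  by (induction n) (auto intro: subtraction_free.intros)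

lemma subtraction_free_prod:
  "(\<And>i. i \<in> I \<Longrightarrow> f i \<in> subtraction_free G) \<Longrightarrow> prod f I \<in> subtraction_free G"
  by (induction I rule: infinite_finite_induct) (auto intro: subtraction_free.intros)

lemma subtraction_free_subset:
  assumes "G \<subseteq> subtraction_free H"
  shows "subtraction_free G \<subseteq> subtraction_free H"
proof
  fix u assume "u \<in> subtraction_free G"
  then show "u \<in> subtraction_free H"
    by induction (use assms in \<open>auto intro: subtraction_free.intros\<close>)
qed

text \<open>
  Fractions of combinations of \<open>X\<close> are closed under the generating operations because \<open>X\<close> is
  closed under products.  Whatever vanishes is the fraction \<open>0 / 1\<close>, and its inverse is \<open>0\<close> again.
\<close>
lemma subtraction_free_fraction:
  fixes X :: "'a::field set"
  assumes one: "1 \<in> X"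
    and mult: "\<And>s t. \<lbrakk>s \<in> X; t \<in> X\<rbrakk> \<Longrightarrow> s * t \<in> X"
    and "G \<subseteq> X" and "z \<in> subtraction_free G"
  shows "\<exists>P Q. P \<in> nat_combinations X \<and> Q \<in> nat_combinations X \<and> Q \<noteq> 0 \<and> z * Q = P"
  using assms(4)
proof induction
  have prod: "P * Q \<in> nat_combinations X"
    if "P \<in> nat_combinations X" "Q \<in> nat_combinations X" for P Q
    using nat_combinations_mult[OF _ that, of X] mult nat_combinations_base by blast
  have base: "1 \<in> nat_combinations X" using one by (rule nat_combinations_base)
  {
    case (gen g)
    then show ?case
      using assms(3) base by (intro exI[of _ g] exI[of _ 1]) (auto intro: nat_combinations_base)
  next
    case one
    show ?case using base by (intro exI[of _ 1]) auto
  next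
    case (add u v)
    then obtain P Q P' Q' where *: "P \<in> nat_combinations X" "Q \<in> nat_combinations X" "Q \<noteq> 0"
      "u * Q = P" "P' \<in> nat_combinations X" "Q' \<in> nat_combinations X" "Q' \<noteq> 0" "v * Q' = P'"
      by blast
    then have "(u + v) * (Q * Q') = P * Q' + P' * Q" by (auto simp: algebra_simps)
    with * show ?case
      by (intro exI[of _ "P * Q' + P' * Q"] exI[of _ "Q * Q'"])
        (auto intro: prod nat_combinations_add)
  next
    case (mult u v)
    then obtain P Q P' Q' where *: "P \<in> nat_combinations X" "Q \<in> nat_combinations X" "Q \<noteq> 0"
      "u * Q = P" "P' \<in> nat_combinations X" "Q' \<in> nat_combinations X" "Q' \<noteq> 0" "v * Q' = P'"
      by blast
    then have "(u * v) * (Q * Q') = P * P'" by (auto simp: algebra_simps)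
    with * show ?case
      by (intro exI[of _ "P * P'"] exI[of _ "Q * Q'"]) (auto intro: prod)
  next
    case (inverse u)
    then obtain P Q where *: "P \<in> nat_combinations X" "Q \<in> nat_combinations X" "Q \<noteq> 0" "u * Q = P"
      by blast
    show ?case
    proof (cases "u = 0")
      case True
      then show ?thesis
        using base nat_combinations_zero by (intro exI[of _ 0] exI[of _ 1]) auto
    next
      case False
      with * show ?thesis by (intro exI[of _ Q] exI[of _ P]) (auto simp: field_simps)
    qed
  }
qed

text \<open>
  The core of the positivity argument.  Write \<open>z * Q = P\<close> with \<open>P\<close> and \<open>Q\<close> combinations of
  elements of \<open>X\<close>, and split off one term of \<open>Q = m + Q'\<close>.  Then \<open>z * m\<close> and \<open>z * Q'\<close> are both
  combinations of \<open>S\<close> with coefficients in \<open>\<nat>\<close>, and their sum involves \<open>X\<close> only, hence so does \<open>z * m\<close>.  Thus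
  a single monomial denominator suffices, and the numerator has nonnegative coefficients.
\<close>
lemma subtraction_free_monomial_denominator:
  fixes S :: "'a::field set"
  assumes ind: "int_independent S"
    and prods: "\<And>s t. \<lbrakk>s \<in> S; t \<in> S\<rbrakk> \<Longrightarrow> s * t \<in> nat_combinations S"
    and "X \<subseteq> S" and one: "1 \<in> X" and mult: "\<And>s t. \<lbrakk>s \<in> X; t \<in> X\<rbrakk> \<Longrightarrow> s * t \<in> X"
    and "G \<subseteq> X" and sf: "z \<in> subtraction_free G" and "z \<in> S"
  shows "\<exists>m\<in>X. z * m \<in> nat_combinations X"
proof -
  obtain P Q where P: "P \<in> nat_combinations X" and Q: "Q \<in> nat_combinations X" "Q \<noteq> 0"
    and PQ: "z * Q = P"
    using subtraction_free_fraction[OF one mult \<open>G \<subseteq> X\<close> sf]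
    by blast
  have "Q \<noteq> 0 \<longrightarrow> (\<exists>m\<in>X. \<exists>Q'\<in>nat_combinations X. Q = m + Q')"
    using Q(1) by (induction rule: nat_combinations_induct) auto
  then obtain m Q' where m: "m \<in> X" "Q' \<in> nat_combinations X" "Q = m + Q'"
    using Q(2) by blast
  have "z * u \<in> nat_combinations S" if "u \<in> nat_combinations X" for u
    using nat_combinations_mult[OF _ nat_combinations_base[OF \<open>z \<in> S\<close>] that, of S] prods \<open>X \<subseteq> S\<close>
    by blast
  then have "z * m \<in> nat_combinations S" "z * Q' \<in> nat_combinations S"
    using m nat_combinations_base by auto
  then have "z * m \<in> nat_combinations X"
    using nat_combinations_summand[OF ind \<open>X \<subseteq> S\<close>] P PQ m(3) by (auto simp: distrib_left)
  then show ?thesis using m(1) by blast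
qed


section \<open>Laurent polynomials\<close>

definition monomials :: "'a::field vec \<Rightarrow> 'a set" where
  "monomials x = {\<Prod>i<dim_vec x. x $ i ^ a i | a :: nat \<Rightarrow> nat. True}"

lemma monomialsI: "(\<Prod>i<dim_vec x. x $ i ^ a i) \<in> monomials x"
  unfolding monomials_def by blast

lemma one_in_monomials: "1 \<in> monomials x"
  using monomialsI[of x "\<lambda>_. 0"] by simp

lemma monomials_mult: "\<lbrakk>s \<in> monomials x; t \<in> monomials x\<rbrakk> \<Longrightarrow> s * t \<in> monomials x"
  unfolding monomials_def by (auto simp: prod.distrib[symmetric] power_add[symmetric])

lemma entry_in_monomials:
  assumes "i < dim_vec x"
  shows "x $ i \<in> monomials x"
proof -
  have "(\<Prod>j<dim_vec x. x $ j ^ (if j = i then 1 else 0)) = (\<Prod>j<dim_vec x. if j = i then x $ j else 1)"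
    by (intro prod.cong) auto
  also have "\<dots> = x $ i" using assms by simp
  finally show ?thesis using monomialsI[of x "\<lambda>j. if j = i then 1 else 0"] by simp
qed

definition nonneg_laurent_values :: "'a::field vec \<Rightarrow> 'a set" where
  "nonneg_laurent_values x =
     {laurent_eval x p | p. laurent_in (dim_vec x) p \<and> nonneg_coeffs p}"

lemma laurent_eval_superset:
  assumes "finite A" "Poly_Mapping.keys p \<subseteq> A"
  shows "laurent_eval x p =
    (\<Sum>e\<in>A. of_int (Poly_Mapping.lookup p e) * (\<Prod>i<dim_vec x. x $ i powi Poly_Mapping.lookup e i))"
  unfolding laurent_eval_def
  by (rule sum.mono_neutral_left) (use assms in \<open>auto simp: in_keys_iff\<close>)

lemma laurent_eval_add: "laurent_eval x (p + q) = laurent_eval x p + laurent_eval x q"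
proof -
  let ?A = "Poly_Mapping.keys p \<union> Poly_Mapping.keys q"
  have "Poly_Mapping.keys (p + q) \<subseteq> ?A" by (rule Poly_Mapping.keys_add)
  then show ?thesis
    using laurent_eval_superset[of ?A p x] laurent_eval_superset[of ?A q x]
      laurent_eval_superset[of ?A "p + q" x]
    by (simp add: lookup_add distrib_right sum.distrib)
qed

lemma nonneg_laurent_values_add:
  assumes "u \<in> nonneg_laurent_values x" "v \<in> nonneg_laurent_values x"
  shows "u + v \<in> nonneg_laurent_values x"
proof -
  obtain p q where *: "u = laurent_eval x p" "laurent_in (dim_vec x) p" "nonneg_coeffs p"
      "v = laurent_eval x q" "laurent_in (dim_vec x) q" "nonneg_coeffs q"
    using assms by (auto simp: nonneg_laurent_values_def)
  then have "laurent_in (dim_vec x) (p + q)"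
    using Poly_Mapping.keys_add[of p q] by (auto simp: laurent_in_def)
  moreover have "nonneg_coeffs (p + q)" using * by (simp add: nonneg_coeffs_def lookup_add)
  ultimately show ?thesis
    using * by (auto simp: nonneg_laurent_values_def laurent_eval_add[symmetric])
qed

lemma laurent_monomial_value:
  fixes c :: "nat \<Rightarrow> int"
  shows "(\<Prod>i<dim_vec x. x $ i powi c i) \<in> nonneg_laurent_values x"
proof -
  define e where "e = (\<Sum>i<dim_vec x. Poly_Mapping.single i (c i))"
  have e: "Poly_Mapping.lookup e i = (if i < dim_vec x then c i else 0)" for i
    by (simp add: e_def lookup_sum lookup_single when_def)
  have "laurent_in (dim_vec x) (Poly_Mapping.single e 1)"
    by (auto simp: laurent_in_def in_keys_iff e split: if_splits)
  moreover have "nonneg_coeffs (Poly_Mapping.single e 1)"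
    by (simp add: nonneg_coeffs_def lookup_single when_def)
  moreover have "laurent_eval x (Poly_Mapping.single e 1) = (\<Prod>i<dim_vec x. x $ i powi c i)"
    by (simp add: laurent_eval_def e)
  ultimately show ?thesis
    unfolding nonneg_laurent_values_def by (intro CollectI exI[of _ "Poly_Mapping.single e 1"]) simp
qed

lemma nat_combination_over_monomial:
  assumes nz: "\<And>i. i < dim_vec x \<Longrightarrow> x $ i \<noteq> 0"
    and m: "m \<in> monomials x" and u: "u \<in> nat_combinations (monomials x)"
  shows "u / m \<in> nonneg_laurent_values x"
  using u
proof (induction rule: nat_combinations_induct)
  case zero
  have "laurent_eval x 0 \<in> nonneg_laurent_values x"
    unfolding nonneg_laurent_values_def
    by (intro CollectI exI[of _ 0]) (simp add: laurent_in_def nonneg_coeffs_def)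
  then show ?case by (simp add: laurent_eval_def)
next
  case (add s u)
  obtain a b where ab: "s = (\<Prod>i<dim_vec x. x $ i ^ a i)" "m = (\<Prod>i<dim_vec x. x $ i ^ b i)"
    using add(1) m by (auto simp: monomials_def)
  have "s / m = (\<Prod>i<dim_vec x. x $ i powi (int (a i) - int (b i)))"
    unfolding ab prod_dividef[symmetric]
    by (intro prod.cong) (use nz in \<open>auto simp: power_int_diff\<close>)
  then have "s / m \<in> nonneg_laurent_values x" by (simp add: laurent_monomial_value)
  then show ?case using add by (simp add: add_divide_distrib nonneg_laurent_values_add)
qed


section \<open>Mutation\<close>

lemma dim_mutate_mat [simp]:
  "dim_row (mutate_mat k B) = dim_row B" "dim_col (mutate_mat k B) = dim_col B"
  by (simp_all add: mutate_mat_def)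

lemma dim_mutate_cluster [simp]: "dim_vec (mutate_cluster k B x) = dim_vec x"
  by (simp add: mutate_cluster_def)

lemma even_abs_mult: "even (\<bar>a\<bar> * b + a * \<bar>b\<bar> :: int)"
  by (cases "even a"; cases "even b") auto

lemma mutate_mat_skew:
  assumes "principal_skew_symmetric B" "dim_col B \<le> dim_row B" "k < dim_col B"
  shows "principal_skew_symmetric (mutate_mat k B)"
  unfolding principal_skew_symmetric_def
proof (intro allI impI)
  fix i j assume ij: "i < dim_col (mutate_mat k B)" "j < dim_col (mutate_mat k B)"
  have skew: "B $$ (s, t) = - B $$ (t, s)" if "s < dim_col B" "t < dim_col B" for s t
    using assms(1) that unfolding principal_skew_symmetric_def by blast
  let ?e = "\<bar>B $$ (i, k)\<bar> * B $$ (k, j) + B $$ (i, k) * \<bar>B $$ (k, j)\<bar>"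
  have "\<bar>B $$ (j, k)\<bar> * B $$ (k, i) + B $$ (j, k) * \<bar>B $$ (k, i)\<bar> = - ?e"
    using skew[of j k] skew[of k i] ij assms(3) by simp
  moreover have "- ?e div 2 = - (?e div 2)"
    using even_abs_mult by (rule dvd_neg_div)
  ultimately show "mutate_mat k B $$ (i, j) = - mutate_mat k B $$ (j, i)"
    using skew[of i j] ij assms(2) by (auto simp: mutate_mat_def)
qed

lemma seeds_invariants:
  assumes "(x, B') \<in> seeds B" "principal_skew_symmetric B" "dim_col B \<le> dim_row B"
  shows "dim_vec x = dim_row B \<and> dim_row B' = dim_row B \<and> dim_col B' = dim_col B \<and>
    principal_skew_symmetric B'"
  using assms(1)
proof (induction rule: seeds.induct)
  case initial
  show ?case using assms(2) by simp
next
  case (mutation x B' k)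
  then show ?case using mutate_mat_skew[of B' k] assms(3) by simp
qed

text \<open>
  Since \<open>b\<^sub>k\<^sub>k = 0\<close>, the exchange relation expresses \<open>x\<^sub>k\<close> by the mutated cluster in the same way
  as it expresses the new variable by the old cluster, so both inclusions follow from
  the same computation.
\<close>
lemma subtraction_free_mutate_cluster:
  fixes x :: "'a::field vec"
  assumes dim: "dim_vec x = dim_row B" and k: "k < dim_row B" and diag: "B $$ (k, k) = 0"
    and nz: "\<And>s t. \<lbrakk>s \<in> monomials x; t \<in> monomials x\<rbrakk> \<Longrightarrow> s + t \<noteq> 0"
  shows "subtraction_free (vec_set (mutate_cluster k B x)) = subtraction_free (vec_set x)"
proof -
  let ?x' = "mutate_cluster k B x"
  define M where "M y = (\<Prod>j | j < dim_row B \<and> B $$ (j, k) > 0. y $ j ^ nat (B $$ (j, k)))"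
    for y :: "'a vec"
  define N where "N y = (\<Prod>j | j < dim_row B \<and> B $$ (j, k) < 0. y $ j ^ nat (- B $$ (j, k)))"
    for y :: "'a vec"
  have x'k: "?x' $ k = (M x + N x) / x $ k"
    using dim k by (simp add: mutate_cluster_def M_def N_def)
  have x'i: "?x' $ i = x $ i" if "i < dim_row B" "i \<noteq> k" for i
    using dim that by (simp add: mutate_cluster_def)
  have unchanged: "?x' $ j = x $ j" if "j < dim_row B" "B $$ (j, k) \<noteq> 0" for j
    using x'i[OF that(1)] that(2) diag by metis
  have MN: "M ?x' = M x" "N ?x' = N x"
    unfolding M_def N_def by (rule prod.cong; simp add: unchanged)+
  have sub: "(\<Prod>j | j < dim_row B \<and> P j. x $ j ^ a j) \<in> monomials x" for P a
  proof -
    have "(\<Prod>j<dim_vec x. x $ j ^ (if P j then a j else 0))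
        = (\<Prod>j<dim_vec x. if P j then x $ j ^ a j else 1)"
      by (intro prod.cong) auto
    also have "\<dots> = (\<Prod>j\<in>{j\<in>{..<dim_vec x}. P j}. x $ j ^ a j)"
      by (rule prod.inter_filter[symmetric]) simp
    also have "{j\<in>{..<dim_vec x}. P j} = {j. j < dim_row B \<and> P j}"
      using dim by auto
    finally show ?thesis
      using monomialsI[of x "\<lambda>j. if P j then a j else 0"] by (simp only:)
  qed
  have "M x + N x \<noteq> 0"
    unfolding M_def N_def by (intro nz sub)
  \<comment> \<open>The numerator cancels, also in the degenerate case \<open>x $ k = 0\<close>.\<close>
  then have xk: "x $ k = (M ?x' + N ?x') / ?x' $ k"
    by (simp add: x'k MN)
  have entries: "y $ i \<in> subtraction_free (vec_set y)" if "i < dim_vec y" for i and y :: "'a vec"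
    using that by (auto simp: vec_set_def intro: subtraction_free.gen)
  have exchange: "(M y + N y) / y $ k \<in> subtraction_free (vec_set y)"
    if y: "dim_vec y = dim_row B" for y
  proof -
    have "M y \<in> subtraction_free (vec_set y)" "N y \<in> subtraction_free (vec_set y)"
      unfolding M_def N_def
      by (intro subtraction_free_prod subtraction_free_power entries; simp add: y)+
    then show ?thesis
      using entries[of k y] k y by (simp add: subtraction_free_divide subtraction_free.add)
  qed
  have "vec_set ?x' \<subseteq> subtraction_free (vec_set x)"
  proof
    fix u assume "u \<in> vec_set ?x'"
    then obtain i where "i < dim_row B" "u = ?x' $ i" using dim by (auto simp: vec_set_def)
    then show "u \<in> subtraction_free (vec_set x)"
      using exchange[OF dim] x'k x'i[of i] entries[of i x] dim by (cases "i = k") auto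
  qed
  moreover have "vec_set x \<subseteq> subtraction_free (vec_set ?x')"
  proof
    fix u assume "u \<in> vec_set x"
    then obtain i where "i < dim_row B" "u = x $ i" using dim by (auto simp: vec_set_def)
    then show "u \<in> subtraction_free (vec_set ?x')"
      using exchange[of ?x'] xk x'i[of i] entries[of i ?x'] dim by (cases "i = k") auto
  qed
  ultimately show ?thesis by (intro equalityI subtraction_free_subset)
qed

lemma cluster_monomials_eq:
  assumes "principal_skew_symmetric B" "dim_col B \<le> dim_row B"
  shows "cluster_monomials B = (\<Union>x\<in>clusters B. monomials x)"
proof -
  have "dim_vec x = dim_row B" if "x \<in> clusters B" for x
    using that seeds_invariants[OF _ assms] by (auto simp: clusters_def)
  then show ?thesis unfolding cluster_monomials_def monomials_def by (intro SUP_cong) auto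
qed

lemma subtraction_free_cluster:
  assumes skew: "principal_skew_symmetric B" and dim: "dim_col B \<le> dim_row B"
    and nz: "\<And>s t. \<lbrakk>s \<in> cluster_monomials B; t \<in> cluster_monomials B\<rbrakk> \<Longrightarrow> s + t \<noteq> 0"
    and "(x, B') \<in> seeds B"
  shows "subtraction_free (vec_set x) = subtraction_free (vec_set (vec (dim_row B) ratvar))"
  using assms(4)
proof (induction rule: seeds.induct)
  case (mutation x B' k)
  note inv = seeds_invariants[OF mutation(1) skew dim]
  have "x \<in> clusters B" using imageI[OF mutation(1), of fst] by (simp add: clusters_def)
  then have "monomials x \<subseteq> cluster_monomials B" using cluster_monomials_eq[OF skew dim] by auto
  moreover have "B' $$ (k, k) = - B' $$ (k, k)"
    using inv mutation(2) unfolding principal_skew_symmetric_def by metis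
  ultimately have "subtraction_free (vec_set (mutate_cluster k B' x)) = subtraction_free (vec_set x)"
    using inv mutation(2) dim nz by (intro subtraction_free_mutate_cluster) auto
  then show ?case using mutation.IH by simp
qed simp


section \<open>The Grothendieck ring\<close>

lemma add_monoid_free_tensor: "add_monoid (free_tensor C) = free_Abelian_group (Obj C)"
  by (simp add: free_tensor_def free_Abelian_group_def)

lemma abelian_group_free_tensor: "abelian_group (free_tensor C)"
  by (intro comm_group_abelian_groupI)
    (unfold add_monoid_free_tensor, rule abelian_free_Abelian_group)

lemma short_exact_objects:
  assumes "category C" "short_exact C X Y Z"
  shows "X \<in> Obj C" "Y \<in> Obj C" "Z \<in> Obj C"
  using assms category.Dom_closed[OF assms(1)] category.Cod_closed[OF assms(1)]
  by (auto simp: short_exact_def Hom_def)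

lemma exact_relations_subgroup:
  assumes "category C"
  shows "subgroup (exact_relations C) (free_Abelian_group (Obj C))"
  unfolding exact_relations_def
proof (rule group.generate_is_subgroup[OF group_free_Abelian_group], clarsimp)
  fix X Y Z e
  assume "short_exact C X Y Z" "e \<in> Poly_Mapping.keys (frag_of Y - frag_of X - frag_of Z)"
  moreover have "Poly_Mapping.keys (frag_of Y - frag_of X - frag_of Z) \<subseteq> {X, Y, Z}"
    using keys_diff[of "frag_of Y - frag_of X" "frag_of Z"] keys_diff[of "frag_of Y" "frag_of X"]
    by auto
  ultimately show "e \<in> Obj C" using short_exact_objects[OF assms] by blast
qed

lemma abelian_subgroup_exact_relations:
  assumes "category C"
  shows "abelian_subgroup (exact_relations C) (free_tensor C)"
  using exact_relations_subgroup[OF assms] abelian_group_free_tensor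
  by (intro abelian_subgroupI3 additive_subgroup.intro) (unfold add_monoid_free_tensor)

lemma abelian_group_grothendieck_ring:
  assumes "category C"
  shows "abelian_group (grothendieck_ring C)"
proof (rule comm_group_abelian_groupI)
  interpret abelian_subgroup "exact_relations C" "free_tensor C"
    using assms by (rule abelian_subgroup_exact_relations)
  show "comm_group (add_monoid (grothendieck_ring C))"
    using a_factorgroup_is_comm_group
    by (simp add: grothendieck_ring_def FactRing_def A_FactGroup_def')
qed

lemma object_class_carrier:
  assumes "X \<in> Obj C"
  shows "object_class C X \<in> carrier (grothendieck_ring C)"
  using assms
  by (auto simp: object_class_def grothendieck_ring_def FactRing_def A_RCOSETS_def' free_tensor_def)

lemma object_class_short_exact:
  assumes "category C" "short_exact C X Y Z"
  shows "object_class C Y = object_class C X \<oplus>\<^bsub>grothendieck_ring C\<^esub> object_class C Z"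
proof -
  interpret abelian_subgroup "exact_relations C" "free_tensor C"
    using assms(1) by (rule abelian_subgroup_exact_relations)
  note objs = short_exact_objects[OF assms]
  have carr: "frag_of V \<in> carrier (free_tensor C)" if "V \<in> Obj C" for V
    using that by (simp add: free_tensor_def)
  have plus: "u \<oplus>\<^bsub>free_tensor C\<^esub> v = u + v" for u v
    by (simp add: free_tensor_def)
  have "frag_of Y - frag_of X - frag_of Z \<in> exact_relations C"
    unfolding exact_relations_def using assms(2) by (intro generate.incl) blast
  then have "(frag_of Y - frag_of X - frag_of Z) \<oplus>\<^bsub>free_tensor C\<^esub> (frag_of X + frag_of Z)
      \<in> exact_relations C +>\<^bsub>free_tensor C\<^esub> (frag_of X + frag_of Z)"
    by (auto simp: a_r_coset_def')
  then have "frag_of Y \<in> exact_relations C +>\<^bsub>free_tensor C\<^esub> (frag_of X + frag_of Z)"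
    by (simp add: plus)
  then have "exact_relations C +>\<^bsub>free_tensor C\<^esub> (frag_of X + frag_of Z) = object_class C Y"
    unfolding object_class_def
    using a_closed[OF carr[OF objs(1)] carr[OF objs(3)]] a_subgroup
    by (intro a_repr_independence) (simp_all add: plus)
  then show ?thesis
    using a_rcos_sum[OF carr[OF objs(1)] carr[OF objs(3)]]
    by (simp add: grothendieck_ring_def FactRing_def object_class_def plus)
qed

lemma frag_extend_add_fun:
  "frag_extend (\<lambda>X. f X + g X) a = frag_extend f a + frag_extend g a"
  by (simp add: frag_extend_def frag_cmul_distrib2 sum.distrib)

text \<open>
  The product of two cosets is defined as a union over all representatives.  They all give the
  same coset because the exact relations absorb products with arbitrary elements on either side.
\<close>
lemma object_class_tensor:
  assumes cat: "category C" and mon: "monoidal_category C" and ten: "tensor_induces_mult C"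
    and X: "X \<in> Obj C" and Y: "Y \<in> Obj C"
  shows "object_class C (X \<boxtimes>\<^bsub>C\<^esub> Y)
    = object_class C X \<otimes>\<^bsub>grothendieck_ring C\<^esub> object_class C Y"
proof -
  let ?F = "free_tensor C" and ?I = "exact_relations C"
  interpret abelian_subgroup ?I ?F
    using cat by (rule abelian_subgroup_exact_relations)
  have carr: "frag_of V \<in> carrier ?F" if "V \<in> Obj C" for V
    using that by (simp add: free_tensor_def)
  have plus: "u \<oplus>\<^bsub>?F\<^esub> v = u + v" for u v by (simp add: free_tensor_def)
  have T: "X \<boxtimes>\<^bsub>C\<^esub> Y \<in> Obj C" using monoidal_category.TObj_closed[OF mon X Y] .
  have frag: "frag_of X \<otimes>\<^bsub>?F\<^esub> frag_of Y = frag_of (X \<boxtimes>\<^bsub>C\<^esub> Y)"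
    by (simp add: free_tensor_def)
  have dist: "(u + v) \<otimes>\<^bsub>?F\<^esub> w = u \<otimes>\<^bsub>?F\<^esub> w + v \<otimes>\<^bsub>?F\<^esub> w"
    "w \<otimes>\<^bsub>?F\<^esub> (u + v) = w \<otimes>\<^bsub>?F\<^esub> u + w \<otimes>\<^bsub>?F\<^esub> v" for u v w
    by (simp_all add: free_tensor_def frag_extend_add frag_extend_add_fun)
  have coset: "?I +>\<^bsub>?F\<^esub> (a \<otimes>\<^bsub>?F\<^esub> b) = ?I +>\<^bsub>?F\<^esub> frag_of (X \<boxtimes>\<^bsub>C\<^esub> Y)"
    if a: "a \<in> ?I +>\<^bsub>?F\<^esub> frag_of X" and b: "b \<in> ?I +>\<^bsub>?F\<^esub> frag_of Y" for a b
  proof -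
    obtain i j where ij: "i \<in> ?I" "a = i + frag_of X" "j \<in> ?I" "b = j + frag_of Y"
      using a b by (auto simp: a_r_coset_def' plus)
    have bc: "b \<in> carrier ?F"
      using a_closed[OF a_Hcarr[OF ij(3)] carr[OF Y]] ij(4) by (simp add: plus)
    have "i \<otimes>\<^bsub>?F\<^esub> b \<in> ?I" "frag_of X \<otimes>\<^bsub>?F\<^esub> j \<in> ?I"
      using ten ij bc carr[OF X] by (auto simp: tensor_induces_mult_def)
    then have "i \<otimes>\<^bsub>?F\<^esub> b + frag_of X \<otimes>\<^bsub>?F\<^esub> j \<in> ?I"
      using a_closed by (metis plus additive_subgroup.a_closed is_additive_subgroup)
    moreover have "a \<otimes>\<^bsub>?F\<^esub> b
        = (i \<otimes>\<^bsub>?F\<^esub> b + frag_of X \<otimes>\<^bsub>?F\<^esub> j) + frag_of (X \<boxtimes>\<^bsub>C\<^esub> Y)"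
      using frag dist ij by (simp add: add.assoc)
    ultimately have "a \<otimes>\<^bsub>?F\<^esub> b \<in> ?I +>\<^bsub>?F\<^esub> frag_of (X \<boxtimes>\<^bsub>C\<^esub> Y)"
      by (auto simp: a_r_coset_def' plus)
    then show ?thesis
      using a_repr_independence[OF _ carr[OF T] a_subgroup] by simp
  qed
  have "frag_of X \<in> ?I +>\<^bsub>?F\<^esub> frag_of X" "frag_of Y \<in> ?I +>\<^bsub>?F\<^esub> frag_of Y"
    using a_rcos_self carr X Y by auto
  then show ?thesis
    using coset by (auto simp: grothendieck_ring_def FactRing_def rcoset_mult_def object_class_def)
qed

text \<open>
  A relation between images is pulled back to \<open>R\<close>, where it gives an expansion of \<open>\<zero>\<close> that
  must agree with the empty one.
\<close>
lemma Z_basis_image_independent: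
  fixes R :: "'b ring" and \<phi> :: "'b \<Rightarrow> 'a::comm_ring_1"
  assumes "abelian_group R" and basis: "is_Z_basis R S" and inj: "inj_on \<phi> (carrier R)"
    and add: "\<And>u v. \<lbrakk>u \<in> carrier R; v \<in> carrier R\<rbrakk> \<Longrightarrow> \<phi> (u \<oplus>\<^bsub>R\<^esub> v) = \<phi> u + \<phi> v"
  shows "int_independent (\<phi> ` S)"
proof (rule int_independentI)
  interpret R: abelian_group R by fact
  have S: "S \<subseteq> carrier R" using basis by (simp add: is_Z_basis_def)
  have zero: "\<phi> \<zero>\<^bsub>R\<^esub> = 0"
    using add[of "\<zero>\<^bsub>R\<^esub>" "\<zero>\<^bsub>R\<^esub>"] by simp
  have minus: "\<phi> (\<ominus>\<^bsub>R\<^esub> s) = - \<phi> s" if "s \<in> carrier R" for s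
    using add[of "\<ominus>\<^bsub>R\<^esub> s" s] that zero by (simp add: R.l_neg eq_neg_iff_add_eq_0)
  have nat_mult: "\<phi> ([n] \<cdot>\<^bsub>R\<^esub> s) = of_nat n * \<phi> s" if "s \<in> carrier R" for s and n :: nat
    by (induction n) (use that add zero in \<open>auto simp: algebra_simps\<close>)
  have int_mult: "\<phi> ([n] \<cdot>\<^bsub>R\<^esub> s) = of_int n * \<phi> s" if "s \<in> carrier R" for s and n :: int
  proof (cases n)
    case (nonneg m)
    then show ?thesis using nat_mult[OF that] by (simp add: add_pow_int_ge)
  next
    case (neg m)
    then have "n < 0" "nat (- n) = Suc m" by auto
    then have "[n] \<cdot>\<^bsub>R\<^esub> s = \<ominus>\<^bsub>R\<^esub> ([Suc m] \<cdot>\<^bsub>R\<^esub> s)" by (simp only: add_pow_int_lt)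
    then have "\<phi> ([n] \<cdot>\<^bsub>R\<^esub> s) = - (of_nat (Suc m) * \<phi> s)"
      using minus[of "[Suc m] \<cdot>\<^bsub>R\<^esub> s"] nat_mult[OF that, of "Suc m"] that
      by (simp only: R.add.nat_pow_closed)
    also have "\<dots> = of_int n * \<phi> s" unfolding neg of_int_minus of_int_of_nat_eq by (rule minus_mult_left)
    finally show ?thesis .
  qed
  have fin: "\<phi> (\<Oplus>\<^bsub>R\<^esub>s\<in>T. f s) = (\<Sum>s\<in>T. \<phi> (f s))"
    if "finite T" "f \<in> T \<rightarrow> carrier R" for f T
    using that by (induction T) (auto simp: zero add R.finsum_insert)
  fix t u v
  assume t: "finite t" "t \<subseteq> \<phi> ` S" "(\<Sum>v\<in>t. of_int (u v) * v) = 0" "v \<in> t"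
  define T where "T = {s \<in> S. \<phi> s \<in> t}"
  have injT: "inj_on \<phi> T" using inj S by (auto simp: T_def inj_on_def)
  have imT: "\<phi> ` T = t" using t(2) by (auto simp: T_def)
  have finT: "finite T" using injT imT t(1) finite_imageD by blast
  define c where "c = (\<Sum>s\<in>T. Poly_Mapping.single s (u (\<phi> s)))"
  have c: "Poly_Mapping.lookup c s = (if s \<in> T then u (\<phi> s) else 0)" for s
    using finT by (simp add: c_def lookup_sum lookup_single when_def)
  have keys: "Poly_Mapping.keys c \<subseteq> T" by (auto simp: in_keys_iff c split: if_splits)
  let ?comb = "\<lambda>c. \<Oplus>\<^bsub>R\<^esub>s\<in>Poly_Mapping.keys c. [Poly_Mapping.lookup c s] \<cdot>\<^bsub>R\<^esub> s"
  have closed: "(\<lambda>s. [Poly_Mapping.lookup c s] \<cdot>\<^bsub>R\<^esub> s) \<in> Poly_Mapping.keys c \<rightarrow> carrier R"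
    using keys S by (auto simp: T_def)
  have "\<phi> (?comb c) = (\<Sum>s\<in>Poly_Mapping.keys c. of_int (Poly_Mapping.lookup c s) * \<phi> s)"
    using fin[OF _ closed] keys S int_mult by (auto simp: T_def intro!: sum.cong)
  also have "\<dots> = (\<Sum>s\<in>T. of_int (Poly_Mapping.lookup c s) * \<phi> s)"
    by (rule sum.mono_neutral_left[OF finT keys]) (auto simp: in_keys_iff)
  also have "\<dots> = (\<Sum>s\<in>T. of_int (u (\<phi> s)) * \<phi> s)" by (simp add: c)
  also have "\<dots> = (\<Sum>v\<in>t. of_int (u v) * v)"
    using sum.reindex[OF injT, of "\<lambda>v. of_int (u v) * v"] imT by simp
  finally have "\<phi> (?comb c) = \<phi> \<zero>\<^bsub>R\<^esub>" using t(3) zero by simp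
  moreover have "?comb c \<in> carrier R" using closed by (rule R.finsum_closed)
  ultimately have "\<zero>\<^bsub>R\<^esub> = ?comb c" using inj by (auto dest: inj_onD)
  moreover have "\<zero>\<^bsub>R\<^esub> = ?comb 0" by simp
  moreover have "Poly_Mapping.keys c \<subseteq> S" "Poly_Mapping.keys (0 :: 'b \<Rightarrow>\<^sub>0 int) \<subseteq> S"
    using keys by (auto simp: T_def)
  moreover have "\<exists>!c. c \<in> carrier (free_Abelian_group S) \<and> \<zero>\<^bsub>R\<^esub> = ?comb c"
    using basis unfolding is_Z_basis_def by simp
  ultimately have "c = 0" unfolding carrier_free_Abelian_group_iff by blast
  moreover obtain s where "s \<in> T" "v = \<phi> s" using t(4) imT by auto
  ultimately show "u v = 0" using c[of s] by simp
qed

text \<open>This makes the class of a zero object idempotent for addition, hence zero.\<close>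
lemma zero_object_short_exact:
  assumes "category C" "is_zero_obj C Z"
  shows "short_exact C Z Z Z"
proof -
  interpret category C by fact
  have Z: "Z \<in> Obj C" using assms(2) by (simp add: is_zero_obj_def)
  let ?i = "Ident C Z"
  have i: "?i \<in> Hom C Z Z" using Z by (rule Ident_closed)
  then have i': "?i \<in> Mor C" "Dom C ?i = Z" "Cod C ?i = Z" by (auto simp: Hom_def)
  have ii: "?i \<star>\<^bsub>C\<^esub> ?i = ?i" using i by (rule Ident_left)
  then have "is_zero_mor C (?i \<star>\<^bsub>C\<^esub> ?i)"
    using assms(2) i i' unfolding is_zero_mor_def by (intro exI[of _ Z] conjI bexI[of _ ?i]) auto
  then have "is_kernel C ?i ?i" "is_cokernel C ?i ?i"
    using i' Ident_left Ident_right unfolding is_kernel_def is_cokernel_def by metis+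
  then show ?thesis using i unfolding short_exact_def by blast
qed

text \<open>Each step of a composition series adds the class of one simple object.\<close>
lemma finite_length_nat_combination:
  fixes \<psi> :: "'o \<Rightarrow> 'a::ab_group_add"
  assumes cat: "category C"
    and exact: "\<And>X Y Z. short_exact C X Y Z \<Longrightarrow> \<psi> Y = \<psi> X + \<psi> Z"
    and "finite_length C X"
  shows "\<psi> X \<in> nat_combinations {\<psi> S | S. is_simple C S}"
  using assms(3)
proof induction
  case (zero Z)
  then have "\<psi> Z = 0" using exact[OF zero_object_short_exact[OF cat]] by simp
  then show ?case by (simp add: nat_combinations_zero)
next
  case (extend X Y S)
  then show ?case
    using exact[of X Y S] by (auto intro!: nat_combinations_add intro: nat_combinations_base)
qed

lemma monoidal_categorification_classes:
  assumes "monoidal_categorification C B"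
  obtains \<psi> where
    "int_independent {\<psi> S | S. is_simple C S}"
    "\<And>s t. \<lbrakk>s \<in> {\<psi> S | S. is_simple C S}; t \<in> {\<psi> S | S. is_simple C S}\<rbrakk>
      \<Longrightarrow> s * t \<in> nat_combinations {\<psi> S | S. is_simple C S}"
    "cluster_monomials B \<subseteq> {\<psi> S | S. is_simple C S}"
proof -
  let ?G = "grothendieck_ring C"
  have cat: "category C" and mon: "monoidal_category C" and fl: "\<And>X. X \<in> Obj C \<Longrightarrow> finite_length C X"
    and ten: "tensor_induces_mult C"
    and basis: "is_Z_basis ?G {object_class C S | S. is_simple C S}"
    using assms by (auto simp: monoidal_categorification_def abelian_category_def)
  obtain \<phi> where iso: "\<phi> \<in> ring_iso ?G (cluster_algebra B)"
    and cm: "cluster_monomials B = {\<phi> (object_class C S) | S. is_real_simple C S}"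
    using assms by (auto simp: monoidal_categorification_def)
  have hom: "\<phi> \<in> Ring.ring_hom ?G (cluster_algebra B)"
    using iso by (auto simp: ring_iso_def)
  have add: "\<phi> (u \<oplus>\<^bsub>?G\<^esub> v) = \<phi> u + \<phi> v" and mult: "\<phi> (u \<otimes>\<^bsub>?G\<^esub> v) = \<phi> u * \<phi> v"
    if "u \<in> carrier ?G" "v \<in> carrier ?G" for u v
    using hom that ring_hom_add[of \<phi> ?G "cluster_algebra B" u v]
      ring_hom_mult[of \<phi> ?G "cluster_algebra B" u v]
    by (simp_all add: cluster_algebra_def ring_of_type_algebra_def)
  have inj: "inj_on \<phi> (carrier ?G)"
    using iso by (auto simp: ring_iso_def bij_betw_def)
  define \<psi> where "\<psi> X = \<phi> (object_class C X)" for X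
  have exact: "\<psi> Y = \<psi> X + \<psi> Z" if "short_exact C X Y Z" for X Y Z
    using object_class_short_exact[OF cat that] short_exact_objects[OF cat that]
    by (simp add: \<psi>_def add object_class_carrier)
  have tensor: "\<psi> X * \<psi> Y = \<psi> (X \<boxtimes>\<^bsub>C\<^esub> Y)" if "X \<in> Obj C" "Y \<in> Obj C" for X Y
    using object_class_tensor[OF cat mon ten that] that by (simp add: \<psi>_def mult object_class_carrier)
  have image: "\<phi> ` {object_class C S | S. is_simple C S} = {\<psi> S | S. is_simple C S}"
    by (auto simp: \<psi>_def)
  show thesis
  proof
    show "int_independent {\<psi> S | S. is_simple C S}"
      using Z_basis_image_independent[OF abelian_group_grothendieck_ring[OF cat] basis inj add]
      unfolding image by blast
    show "cluster_monomials B \<subseteq> {\<psi> S | S. is_simple C S}"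
      unfolding cm \<psi>_def by (auto simp: is_real_simple_def)
    fix s t assume "s \<in> {\<psi> S | S. is_simple C S}" "t \<in> {\<psi> S | S. is_simple C S}"
    then obtain X Y where XY: "s = \<psi> X" "t = \<psi> Y" "X \<in> Obj C" "Y \<in> Obj C"
      by (auto simp: is_simple_def)
    then show "s * t \<in> nat_combinations {\<psi> S | S. is_simple C S}"
      using tensor finite_length_nat_combination[of C \<psi>, OF cat exact fl]
        monoidal_category.TObj_closed[OF mon] by simp
  qed
qed


section \<open>Positivity and linear independence\<close>

theorem proposition2p2:
  fixes r n :: nat and B :: "int mat" and M :: "('o, 'm) monoidal_data"
  assumes "n < r"
    and "B \<in> carrier_mat r (r - n)"
    and "principal_skew_symmetric B"
    and "monoidal_categorification M B"
  shows "(\<forall>z \<in> cluster_variables B. \<forall>x \<in> clusters B.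
            \<exists>p. laurent_in r p \<and> nonneg_coeffs p \<and> z = laurent_eval x p) \<and>
         module.independent (\<lambda>(c::int) (z::ratfun). of_int c * z) (cluster_monomials B)"
proof -
  note skew = assms(3)
  have dims: "dim_row B = r" "dim_col B \<le> dim_row B" using assms(2) by auto
  obtain \<psi> where ind: "int_independent {\<psi> S | S. is_simple M S}"
    and prods: "\<And>s t. \<lbrakk>s \<in> {\<psi> S | S. is_simple M S}; t \<in> {\<psi> S | S. is_simple M S}\<rbrakk>
      \<Longrightarrow> s * t \<in> nat_combinations {\<psi> S | S. is_simple M S}"
    and cm: "cluster_monomials B \<subseteq> {\<psi> S | S. is_simple M S}"
    using monoidal_categorification_classes[OF assms(4)] by blast
  let ?S = "{\<psi> S | S. is_simple M S}"
  have nz: "s + t \<noteq> 0" if "s \<in> cluster_monomials B" "t \<in> cluster_monomials B" for s t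
    using int_independent_add_nonzero[OF ind, of s t] that cm nat_combinations_base by blast
  have mono_S: "monomials x \<subseteq> ?S" if "x \<in> clusters B" for x
    using cm cluster_monomials_eq[OF skew dims(2)] that by blast
  have dim: "dim_vec x = r" if "x \<in> clusters B" for x
    using that seeds_invariants[OF _ skew dims(2)] dims by (auto simp: clusters_def)
  have same: "subtraction_free (vec_set x) = subtraction_free (vec_set y)"
    if "x \<in> clusters B" "y \<in> clusters B" for x y
    using that subtraction_free_cluster[OF skew dims(2) nz] by (auto simp: clusters_def)
  have "\<exists>p. laurent_in r p \<and> nonneg_coeffs p \<and> z = laurent_eval x p"
    if z: "z \<in> cluster_variables B" and x: "x \<in> clusters B" for z x
  proof -
    obtain y :: "ratfun vec" and i where y: "y \<in> clusters B" "i < r" "z = y $ i"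
      using z dims by (auto simp: cluster_variables_def)
    have "z \<in> ?S" using mono_S[OF y(1)] entry_in_monomials[of i y] dim[OF y(1)] y by auto
    have "z \<in> subtraction_free (vec_set y)"
      using y dim[OF y(1)] by (auto simp: vec_set_def intro: subtraction_free.gen)
    then have sf: "z \<in> subtraction_free (vec_set x)" using same[OF x y(1)] by simp
    have "vec_set x \<subseteq> monomials x" using entry_in_monomials by (auto simp: vec_set_def)
    then obtain m where m: "m \<in> monomials x" "z * m \<in> nat_combinations (monomials x)"
      using subtraction_free_monomial_denominator[OF ind prods mono_S[OF x] one_in_monomials
          monomials_mult _ sf \<open>z \<in> ?S\<close>] by blast
    have nonzero: "s \<noteq> 0" if "s \<in> monomials x" for s
      using int_independent_nonzero[OF ind] mono_S[OF x] that by blast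
    have "z * m / m \<in> nonneg_laurent_values x"
      using nonzero entry_in_monomials m by (intro nat_combination_over_monomial) auto
    then show ?thesis using nonzero[OF m(1)] dim[OF x] by (auto simp: nonneg_laurent_values_def)
  qed
  moreover have "int_independent (cluster_monomials B)"
    using int_independent_mono[OF ind cm] .
  ultimately show ?thesis by blast
qed

end
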